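(* Let $k>1$. For $i\in\{1,\ldots,2k-1\}$ let $\Sigma_i^k$ be the set of vertices $v_0v_1\cdots v_{2k-1}$ of $ST^2_k$ such that $v_0=v_i$. Then each $\Sigma_i^k$ is an efficient dominating set (E-set) of $ST^2_k$, and the $2k-1$ sets $\Sigma_1^k,\ldots,\Sigma_{2k-1}^k$ form a partition of $V(ST^2_k)$.
   Context: $ST^2_k$ has as vertices all strings $v_0\cdots v_{2k-1}$ over $\{0,\ldots,k-1\}$ in which each symbol occurs exactly twice; $v,w$ are adjacent iff $w$ arises from $v$ by swapping $v_0$ with some $v_j$ ($1\le j\le 2k-1$) with $v_j\neq v_0$. A set $S\subseteq V(G)$ is an efficient dominating set (E-set) if every vertex of $V(G)\setminus S$ is adjacent to exactly one vertex of $S$. *)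

theory Defs
  imports "Graph_Theory.Pair_Digraph" "HOL-Library.Disjoint_Sets"
begin

definition ST2_verts :: "nat \<Rightarrow> nat list set" where
  "ST2_verts k =
     {v. length v = 2 * k \<and> set v \<subseteq> {..<k} \<and> (\<forall>a<k. count_list v a = 2)}"

definition swap0 :: "nat \<Rightarrow> 'a list \<Rightarrow> 'a list" where
  "swap0 j v = v[0 := v ! j, j := v ! 0]"

text \<open>The undirected graph is represented by its symmetric arc relation;
  see the lemma \<open>pair_graph_ST2\<close> below.\<close>

definition ST2 :: "nat \<Rightarrow> nat list pair_pre_digraph" where
  "ST2 k = \<lparr> pverts = ST2_verts k,
     parcs = {(v, w). v \<in> ST2_verts k \<and> w \<in> ST2_verts k \<and>
       (\<exists>j\<in>{1..2 * k - 1}. v ! j \<noteq> v ! 0 \<and> w = swap0 j v)} \<rparr>"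

definition E_set :: "('a, 'b) pre_digraph \<Rightarrow> 'a set \<Rightarrow> bool" where
  "E_set G S \<longleftrightarrow> S \<subseteq> verts G \<and>
     (\<forall>v \<in> verts G - S. \<exists>!s. s \<in> S \<and> v \<rightarrow>\<^bsub>G\<^esub> s)"

definition Sigma_set :: "nat \<Rightarrow> nat \<Rightarrow> nat list set" where
  "Sigma_set k i = {v \<in> pverts (ST2 k). v ! 0 = v ! i}"

lemma finite_ST2_verts: "finite (ST2_verts k)"
  by (rule finite_subset[OF _ finite_lists_length_eq[of "{..<k}" "2 * k"]])
     (auto simp: ST2_verts_def)

lemma swap0_swap0:
  assumes "j < length v"
  shows "swap0 j (swap0 j v) = v"
proof -
  have "0 < length v" using assms by auto
  with assms show ?thesis
    by (intro nth_equalityI) (auto simp: swap0_def nth_list_update)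
qed

lemma pair_graph_ST2: "pair_graph (ST2 k)"
proof
  show "finite (pverts (ST2 k))"
    by (simp add: ST2_def finite_ST2_verts)
  show "finite (parcs (ST2 k))"
    by (rule finite_subset[of _ "ST2_verts k \<times> ST2_verts k"])
       (auto simp: ST2_def finite_ST2_verts)
  show "symmetric (with_proj (ST2 k))"
    unfolding symmetric_def
  proof (rule symI)
    fix v w assume "(v, w) \<in> arcs_ends (with_proj (ST2 k))"
    then obtain j where v: "v \<in> ST2_verts k" and w: "w \<in> ST2_verts k"
      and j: "j \<in> {1..2 * k - 1}" "v ! j \<noteq> v ! 0" "w = swap0 j v"
      by (auto simp: ST2_def)
    have len: "j < length v" "0 < length v" "j \<noteq> 0"
      using v j(1) by (auto simp: ST2_verts_def)
    have "v = swap0 j w" "w ! j \<noteq> w ! 0"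
      using len j by (auto simp: swap0_swap0) (auto simp: swap0_def)
    with v w j(1) show "(w, v) \<in> arcs_ends (with_proj (ST2 k))"
      by (auto simp: ST2_def)
  qed
next
  fix e assume "e \<in> parcs (ST2 k)"
  then obtain v w j where e: "e = (v, w)" and v: "v \<in> ST2_verts k"
    and w: "w \<in> ST2_verts k"
    and j: "j \<in> {1..2 * k - 1}" "v ! j \<noteq> v ! 0" "w = swap0 j v"
    by (auto simp: ST2_def)
  have "0 < length v" "j \<noteq> 0" using v j(1) by (auto simp: ST2_verts_def)
  with j have "w ! 0 \<noteq> v ! 0" by (auto simp: swap0_def)
  then show "fst e \<noteq> snd e" using e by auto
  show "fst e \<in> pverts (ST2 k)" "snd e \<in> pverts (ST2 k)"
    using e v w by (auto simp: ST2_def)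
qed

end

theory Submission
  imports Defs "HOL-Library.Multiset"
begin

text \<open>Every position of a vertex has exactly one partner, the other position carrying the same
  symbol. A vertex lies in exactly one of the sets because position \<open>0\<close> has exactly one partner. If
  \<open>v ! 0 \<noteq> v ! i\<close>, then swapping position \<open>0\<close> with \<open>j\<close> lands in the \<open>i\<close>-th set iff \<open>j\<close> is the partner
  of \<open>i\<close>, hence the set dominates efficiently.\<close>

lemma ex1_partner:
  assumes v: "v \<in> ST2_verts k" and p: "p < 2 * k"
  shows "\<exists>!q. q < 2 * k \<and> q \<noteq> p \<and> v ! q = v ! p"
proof -
  let ?P = "{q. q < 2 * k \<and> v ! q = v ! p}"
  have len: "length v = 2 * k" using v by (simp add: ST2_verts_def)
  have "v ! p \<in> set v" using p len by simp
  hence "count_list v (v ! p) = 2" using v by (auto simp: ST2_verts_def)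
  \<comment> \<open>The bound \<open>length v\<close> and the orientation of the equation match the
    set of positions that \<open>length_filter_conv_card\<close> yields for
    \<open>count_list\<close>.\<close>
  moreover have "?P = {q. q < length v \<and> v ! p = v ! q}" using len by auto
  ultimately have "card ?P = 2"
    by (simp only: count_list_eq_length_filter length_filter_conv_card)
  moreover have "p \<in> ?P" using p by simp
  ultimately have "card (?P - {p}) = 1" by simp
  then obtain q where "?P - {p} = {q}" by (auto simp: card_1_singleton_iff)
  hence "q' < 2 * k \<and> q' \<noteq> p \<and> v ! q' = v ! p \<longleftrightarrow> q' = q" for q'
    by (auto simp: set_eq_iff)
  thus ?thesis by simp
qed

text \<open>A swap permutes the entries, so the multiset of symbols, which determines being a
  vertex, is preserved.\<close>

lemma swap0_in_ST2_verts:
  assumes v: "v \<in> ST2_verts k" and j: "j < 2 * k"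
  shows "swap0 j v \<in> ST2_verts k"
proof -
  have "mset (swap0 j v) = mset v"
    using v j unfolding swap0_def by (intro mset_swap) (auto simp: ST2_verts_def)
  thus ?thesis
    using v unfolding ST2_verts_def
    by (auto simp: count_mset[symmetric] dest: mset_eq_setD mset_eq_length)
qed

lemma adj_ST2_iff:
  "v \<rightarrow>\<^bsub>with_proj (ST2 k)\<^esub> s \<longleftrightarrow>
    v \<in> ST2_verts k \<and> (\<exists>j\<in>{1..2 * k - 1}. v ! j \<noteq> v ! 0 \<and> s = swap0 j v)"
proof -
  have "swap0 j v \<in> ST2_verts k" if "v \<in> ST2_verts k" "j \<in> {1..2 * k - 1}" for j
    using that by (intro swap0_in_ST2_verts) auto
  thus ?thesis by (auto simp: ST2_def)
qed

lemma Sigma_set_iff: "v \<in> Sigma_set k i \<longleftrightarrow> v \<in> ST2_verts k \<and> v ! 0 = v ! i"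
  by (simp add: Sigma_set_def ST2_def)

text \<open>The swap brings \<open>v ! j\<close> to the front and leaves \<open>v ! i\<close> in
  place unless \<open>j = i\<close>. In that case it merely exchanges two different symbols, so
  positions \<open>0\<close> and \<open>i\<close> still disagree.\<close>

lemma swap0_in_Sigma_set_iff:
  assumes v: "v \<in> ST2_verts k" and i: "i \<in> {1..2 * k - 1}" and ne: "v ! 0 \<noteq> v ! i"
    and j: "j \<in> {1..2 * k - 1}"
  shows "swap0 j v \<in> Sigma_set k i \<longleftrightarrow> j \<noteq> i \<and> v ! j = v ! i"
proof -
  have "length v = 2 * k" using v by (simp add: ST2_verts_def)
  hence "swap0 j v ! 0 = v ! j" "swap0 j v ! i = (if j = i then v ! 0 else v ! i)"
    using i j by (auto simp: swap0_def nth_list_update)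
  moreover have "swap0 j v \<in> ST2_verts k"
    using v j by (intro swap0_in_ST2_verts) auto
  ultimately show ?thesis using ne by (auto simp: Sigma_set_iff)
qed

lemma E_set_Sigma_set:
  assumes i: "i \<in> {1..2 * k - 1}"
  shows "E_set (with_proj (ST2 k)) (Sigma_set k i)"
  unfolding E_set_def
proof (intro conjI ballI)
  show "Sigma_set k i \<subseteq> verts (with_proj (ST2 k))"
    by (auto simp: Sigma_set_def)
next
  fix v assume "v \<in> verts (with_proj (ST2 k)) - Sigma_set k i"
  hence v: "v \<in> ST2_verts k" and ne: "v ! 0 \<noteq> v ! i"
    by (auto simp: ST2_def Sigma_set_iff)
  have "i < 2 * k" using i by auto
  then obtain q where q: "q < 2 * k" "q \<noteq> i" "v ! q = v ! i"
    and uniq: "\<And>j. j < 2 * k \<Longrightarrow> j \<noteq> i \<Longrightarrow> v ! j = v ! i \<Longrightarrow> j = q"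
    using ex1_partner[OF v] by metis
  \<comment> \<open>The partner of \<open>i\<close> carries a symbol other than
    \<open>v ! 0\<close>, so swapping it to the front is an admissible move.\<close>
  have "q \<noteq> 0" using q(3) ne by metis
  hence q_range: "q \<in> {1..2 * k - 1}" using q(1) by auto
  show "\<exists>!s. s \<in> Sigma_set k i \<and> v \<rightarrow>\<^bsub>with_proj (ST2 k)\<^esub> s"
  proof (rule ex1I[of _ "swap0 q v"])
    show "swap0 q v \<in> Sigma_set k i \<and> v \<rightarrow>\<^bsub>with_proj (ST2 k)\<^esub> swap0 q v"
      unfolding swap0_in_Sigma_set_iff[OF v i ne q_range] adj_ST2_iff
      using v q q_range ne by metis
  next
    fix s assume s: "s \<in> Sigma_set k i \<and> v \<rightarrow>\<^bsub>with_proj (ST2 k)\<^esub> s"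
    then obtain j where j: "j \<in> {1..2 * k - 1}" "s = swap0 j v"
      unfolding adj_ST2_iff by blast
    with s have "j \<noteq> i" "v ! j = v ! i"
      using swap0_in_Sigma_set_iff[OF v i ne j(1)] by auto
    moreover have "j < 2 * k" using j(1) by auto
    ultimately show "s = swap0 q v" using uniq j(2) by blast
  qed
qed

lemma ST2_verts_nonempty: "ST2_verts k \<noteq> {}"
proof -
  have "count_list [0..<k] a = 1" if "a < k" for a
    using that by (simp add: count_mset[symmetric] count_mset_0_iff)
  \<comment> \<open>Each symbol below \<open>k\<close> occurs once in either half.\<close>
  hence "[0..<k] @ [0..<k] \<in> ST2_verts k"
    by (auto simp: ST2_verts_def)
  thus ?thesis by blast
qed

text \<open>With \<open>S\<close> empty, any vertex would lie outside \<open>S\<close> and have no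
  neighbour in it.\<close>

lemma E_set_nonempty:
  assumes "E_set G S" "verts G \<noteq> {}"
  shows "S \<noteq> {}"
  using assms by (auto simp: E_set_def)

lemma Sigma_set_nonempty:
  assumes "i \<in> {1..2 * k - 1}"
  shows "Sigma_set k i \<noteq> {}"
  using E_set_nonempty[OF E_set_Sigma_set[OF assms]] ST2_verts_nonempty[of k]
  by (simp add: ST2_def)

text \<open>The admissible indices \<open>i\<close> are exactly the partners of position
  \<open>0\<close>; \<open>k > 0\<close> ensures that this position exists.\<close>

lemma ex1_Sigma_set:
  assumes "v \<in> ST2_verts k" "k > 0"
  shows "\<exists>!i. i \<in> {1..2 * k - 1} \<and> v \<in> Sigma_set k i"
proof -
  have "i < 2 * k \<and> i \<noteq> 0 \<and> v ! i = v ! 0 \<longleftrightarrow> i \<in> {1..2 * k - 1} \<and> v \<in> Sigma_set k i" for i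
    using assms by (auto simp: Sigma_set_iff)
  thus ?thesis using ex1_partner[of v k 0] assms by simp
qed

lemma Sigma_set_disjoint:
  assumes "i \<in> {1..2 * k - 1}" "j \<in> {1..2 * k - 1}" "i \<noteq> j"
  shows "Sigma_set k i \<inter> Sigma_set k j = {}"
proof (rule ccontr)
  assume "Sigma_set k i \<inter> Sigma_set k j \<noteq> {}"
  then obtain v where v: "v \<in> Sigma_set k i" "v \<in> Sigma_set k j" by blast
  \<comment> \<open>For \<open>k = 0\<close> the truncated subtraction makes the index range
    empty.\<close>
  have "k > 0" using assms(1) by auto
  with v ex1_Sigma_set[of v k] assms show False by (metis Sigma_set_iff)
qed

theorem theorem18:
  fixes k :: nat
  assumes "k > 1"
  shows "(\<forall>i\<in>{1..2 * k - 1}. E_set (with_proj (ST2 k)) (Sigma_set k i)) \<and>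
    inj_on (Sigma_set k) {1..2 * k - 1} \<and>
    partition_on (pverts (ST2 k)) (Sigma_set k ` {1..2 * k - 1})"
proof (intro conjI ballI)
  show "E_set (with_proj (ST2 k)) (Sigma_set k i)" if "i \<in> {1..2 * k - 1}" for i
    using that by (rule E_set_Sigma_set)
  show "inj_on (Sigma_set k) {1..2 * k - 1}"
  proof (rule inj_onI)
    fix i j assume "i \<in> {1..2 * k - 1}" "j \<in> {1..2 * k - 1}" "Sigma_set k i = Sigma_set k j"
    \<comment> \<open>For distinct indices, equal sets would be disjoint from themselves, hence
      empty.\<close>
    thus "i = j" using Sigma_set_disjoint[of i k j] Sigma_set_nonempty[of i k] by auto
  qed
  show "partition_on (pverts (ST2 k)) (Sigma_set k ` {1..2 * k - 1})"
  proof (rule partition_onI)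
    show "\<Union> (Sigma_set k ` {1..2 * k - 1}) = pverts (ST2 k)"
    proof
      show "pverts (ST2 k) \<subseteq> \<Union> (Sigma_set k ` {1..2 * k - 1})"
      proof
        fix v assume "v \<in> pverts (ST2 k)"
        hence "v \<in> ST2_verts k" by (simp add: ST2_def)
        thus "v \<in> \<Union> (Sigma_set k ` {1..2 * k - 1})"
          using ex1_Sigma_set[of v k] assms by blast
      qed
    qed (auto simp: Sigma_set_def)
  next
    fix A B assume "A \<in> Sigma_set k ` {1..2 * k - 1}" "B \<in> Sigma_set k ` {1..2 * k - 1}" "A \<noteq> B"
    \<comment> \<open>Different blocks necessarily come from different indices.\<close>
    thus "disjnt A B" using Sigma_set_disjoint unfolding disjnt_def by blast
  next
    show "{} \<notin> Sigma_set k ` {1..2 * k - 1}" using Sigma_set_nonempty by blast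
  qed
qed

end
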